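(* Let $f_0=f_0(x,v)\ge0$ be $C^1$, compactly supported on $\mathbb{R}\times\mathbb{R}^2$ and not identically zero, and let $f(t,x,v)$ be the corresponding global solution of the monocharged classical Vlasov-Poisson system with $f(0,x,v)=f_0(x,v)$. Define $$Q_1(t)=\sup\{|v_1| : \text{there are } x,v_2\in\mathbb{R} \text{ such that } f(t,x,v_1,v_2)\ne0\}.$$ Then there are $T,C_1,C_2>0$ such that for all $t\ge T$, $$C_1t\le Q_1(t)\le C_2t.$$
   Context: The monocharged ``one and one-half dimensional'' classical Vlasov-Poisson system, for the unknown $f=f(t,x,v)\ge 0$ (particle number density), $t\ge 0$, $x\in\mathbb{R}$, $v=(v_1,v_2)\in\mathbb{R}^2$, is $$\partial_t f+v_1\,\partial_x f+E_1\,\partial_{v_1}f=0,\qquad \rho(t,x)=\int_{\mathbb{R}^2} f(t,x,v)\,dv,$$ $$E_1(t,x)=\frac12\left(\int_{-\infty}^x\rho(t,y)\,dy-\int_x^\infty\rho(t,y)\,dy\right).$$ For initial data $f(0,x,v)=f_0(x,v)$ that are $C^1$, nonnegative and compactly supported, it is known that there is a solution that is $C^1$ for all $t\ge0$, with $f(t,\cdot,\cdot)$ compactly supported for each $t\geq 0$; solutions are understood in this sense. The constants $T,C_1,C_2$ may depend on $f_0$ but not on $t$. *)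

theory Defs
  imports "HOL-Analysis.Analysis"
begin

text \<open>Frechet derivatives are taken within the set, so at boundary points of a half-space they are
  one-sided.\<close>

definition C1_on :: "'a::real_normed_vector set \<Rightarrow> ('a \<Rightarrow> 'b::real_normed_vector) \<Rightarrow> bool" where
  "C1_on S g \<longleftrightarrow>
     (\<exists>g' :: 'a \<Rightarrow> 'a \<Rightarrow>\<^sub>L 'b.
        (\<forall>z\<in>S. (g has_derivative blinfun_apply (g' z)) (at z within S)) \<and> continuous_on S g')"

definition compactly_supported :: "('a::topological_space \<Rightarrow> 'b::zero) \<Rightarrow> bool" where
  "compactly_supported g \<longleftrightarrow> compact (closure {z. g z \<noteq> 0})"

text \<open>Densities are written \<open>f t x v\<close> with \<open>v = (v\<^sub>1, v\<^sub>2)\<close>. Only the values for \<open>t \<ge> 0\<close> matter.\<close>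

definition rho :: "(real \<Rightarrow> real \<Rightarrow> real \<times> real \<Rightarrow> real) \<Rightarrow> real \<Rightarrow> real \<Rightarrow> real" where
  "rho f t x = (LINT v|lborel. f t x v)"

definition E1 :: "(real \<Rightarrow> real \<Rightarrow> real \<times> real \<Rightarrow> real) \<Rightarrow> real \<Rightarrow> real \<Rightarrow> real" where
  "E1 f t x = 1 / 2 * ((LINT y:{..x}|lborel. rho f t y) - (LINT y:{x..}|lborel. rho f t y))"

definition vlasov_equation_at ::
    "(real \<Rightarrow> real \<Rightarrow> real \<times> real \<Rightarrow> real) \<Rightarrow> real \<Rightarrow> real \<Rightarrow> real \<Rightarrow> real \<Rightarrow> bool" where
  "vlasov_equation_at f t x v1 v2 \<longleftrightarrow>
     (\<exists>ft fx fv1.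
        ((\<lambda>s. f s x (v1, v2)) has_real_derivative ft) (at t within {0..}) \<and>
        ((\<lambda>y. f t y (v1, v2)) has_real_derivative fx) (at x) \<and>
        ((\<lambda>w. f t x (w, v2)) has_real_derivative fv1) (at v1) \<and>
        ft + v1 * fx + E1 f t x * fv1 = 0)"

definition vlasov_poisson_solution ::
    "(real \<Rightarrow> real \<times> real \<Rightarrow> real) \<Rightarrow> (real \<Rightarrow> real \<Rightarrow> real \<times> real \<Rightarrow> real) \<Rightarrow> bool" where
  "vlasov_poisson_solution f0 f \<longleftrightarrow>
     C1_on ({0..} \<times> UNIV) (\<lambda>(t, x, v). f t x v) \<and>
     (\<forall>t\<ge>0. compactly_supported (\<lambda>(x, v). f t x v)) \<and>
     (\<forall>t\<ge>0. \<forall>x v. 0 \<le> f t x v) \<and>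
     (\<forall>t\<ge>0. \<forall>x v1 v2. vlasov_equation_at f t x v1 v2) \<and>
     (\<forall>x v. f 0 x v = f0 x v)"

definition Q1 :: "(real \<Rightarrow> real \<Rightarrow> real \<times> real \<Rightarrow> real) \<Rightarrow> real \<Rightarrow> real" where
  "Q1 f t = Sup {\<bar>v1\<bar> | v1. \<exists>x v2. f t x (v1, v2) \<noteq> 0}"

end

(*
Along a solution mass is conserved, so |E1| is at most half the mass M and v1 grows at most linearly.
For the lower bound let A(t) be the integral of E1 j over x, with rho, j, k the moments of f of order
0, 1, 2 in v1. Since E1_x = rho, E1_t = -j and j_t = -k_x + E1 rho,
A' = int (rho k - j^2) + int E1^2 rho, where the first integral is nonnegative by Cauchy-Schwarz and the
second is the integral of (E1^3/3)_x, that is M^3/12. As |A| <= Q1 M^2/2, Q1 grows at least linearly.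

Compact support is only assumed at each single time. That it is locally uniform in time follows from a
maximum principle on backward cones, which propagates support bounds as long as the mass is bounded,
together with Baire's theorem.
*)
theory Submission
  imports Defs
begin

section \<open>Domain of dependence\<close>

text \<open>Every moment identity differentiates under an integral, so it needs a support box common
  to an interval of times, while the hypotheses bound the support at single times only. Closing this
  gap looks circular: a cone has finite width only if \<open>E1\<close> is bounded,
  \<open>E1\<close> is bounded by half the mass, and conservation of mass is available only where a
  common box already exists. Baire's theorem breaks the circle with one bound shared by all singular
  times near one of them. The maximum principle replaces the flow of characteristics, since no
  regularity of \<open>E1\<close> in time is known before the support is under control. In the lower
  bound, integration by parts turns the integral of -E1 k_x into that of rho k because E1_x = rho,
  which is what pairs with j^2 in Cauchy-Schwarz. The value M^3/12 is the increment of E1^3/3 as E1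
  runs from -M/2 to M/2.\<close>

locale vlasov_poisson =
  fixes f :: "real \<Rightarrow> real \<Rightarrow> real \<times> real \<Rightarrow> real"
    and D :: "real \<times> real \<times> real \<times> real \<Rightarrow> (real \<times> real \<times> real \<times> real) \<Rightarrow>\<^sub>L real"
  assumes has_derivative_f:
      "z \<in> {0..} \<times> UNIV \<Longrightarrow>
        ((\<lambda>(t, x, v). f t x v) has_derivative blinfun_apply (D z)) (at z within {0..} \<times> UNIV)"
    and continuous_D: "continuous_on ({0..} \<times> UNIV) D"
    and compactly_supported_f: "0 \<le> t \<Longrightarrow> compactly_supported (\<lambda>(x, v). f t x v)"
    and nonneg: "0 \<le> t \<Longrightarrow> 0 \<le> f t x u"
    and equation: "0 \<le> t \<Longrightarrow> vlasov_equation_at f t x v w"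
begin

text \<open>Chain rule for paths that may touch or lie in the boundary \<open>t = 0\<close>: the
  derivative of \<open>f\<close> within the half-space is restricted to the image of the path. All
  partial derivatives are special cases.\<close>

lemma has_real_derivative_path:
  assumes "(a has_real_derivative a') (at s within I)" "(b has_real_derivative b') (at s within I)"
    "(c has_real_derivative c') (at s within I)" "(d has_real_derivative d') (at s within I)"
    and nonneg: "\<And>s. s \<in> I \<Longrightarrow> 0 \<le> a s" and "s \<in> I"
  shows "((\<lambda>s. f (a s) (b s) (c s, d s)) has_real_derivative
          D (a s, b s, c s, d s) (a', b', c', d')) (at s within I)"
proof -
  let ?p = "\<lambda>s. (a s, b s, c s, d s)"
  have p: "(?p has_derivative (\<lambda>h. (a' * h, b' * h, c' * h, d' * h))) (at s within I)"
    using assms(1-4) by (intro has_derivative_Pair) (auto simp: has_field_derivative_def)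
  have "((\<lambda>(t, x, v). f t x v) has_derivative blinfun_apply (D (?p s)))
      (at (?p s) within ?p ` I)"
    by (rule has_derivative_subset[OF has_derivative_f]) (use nonneg \<open>s \<in> I\<close> in auto)
  from has_derivative_in_compose[OF p this]
  have "((\<lambda>s. f (a s) (b s) (c s, d s)) has_derivative
      (\<lambda>h. D (?p s) (a' * h, b' * h, c' * h, d' * h))) (at s within I)"
    by simp
  moreover have "D (?p s) (a' * h, b' * h, c' * h, d' * h) = D (?p s) (a', b', c', d') * h" for h
    using blinfun.scaleR_right[of "D (?p s)" h "(a', b', c', d')"] by (simp add: mult.commute)
  ultimately show ?thesis
    by (simp add: has_field_derivative_def)
qed

lemma has_derivative_t:
  "((\<lambda>s. f s x v) has_real_derivative D (t, x, v) (1, 0, 0, 0)) (at t within I)"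
  if "t \<in> I" "I \<subseteq> {0..}"
  using has_real_derivative_path[of "\<lambda>s. s" 1 t I "\<lambda>_. x" 0 "\<lambda>_. fst v" 0 "\<lambda>_. snd v" 0] that
  by auto

lemma has_derivative_x:
  "((\<lambda>y. f t y v) has_real_derivative D (t, x, v) (0, 1, 0, 0)) (at x within I)"
  if "0 \<le> t" "x \<in> I"
  using has_real_derivative_path[of "\<lambda>_. t" 0 x I "\<lambda>s. s" 1 "\<lambda>_. fst v" 0 "\<lambda>_. snd v" 0] that
  by auto

lemma has_derivative_v1:
  "((\<lambda>u. f t x (u, w)) has_real_derivative D (t, x, v, w) (0, 0, 1, 0)) (at v within I)"
  if "0 \<le> t" "v \<in> I"
  using has_real_derivative_path[of "\<lambda>_. t" 0 v I "\<lambda>_. x" 0 "\<lambda>s. s" 1 "\<lambda>_. w" 0] that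
  by auto

text \<open>Uniqueness of derivatives identifies the partial derivatives in the equation with those
  of \<open>D\<close>; linearity of \<open>D\<close> then assembles them into the derivative along
  the characteristic direction.\<close>

lemma vlasov: "D (t, x, v, w) (1, v, E1 f t x, 0) = 0" if t: "0 \<le> t"
proof -
  obtain ft fx fv where ft: "((\<lambda>s. f s x (v, w)) has_real_derivative ft) (at t within {0..})"
    and fx: "((\<lambda>y. f t y (v, w)) has_real_derivative fx) (at x)"
    and fv: "((\<lambda>u. f t x (u, w)) has_real_derivative fv) (at v)"
    and eq: "ft + v * fx + E1 f t x * fv = 0"
    using equation[OF t, of x v w] unfolding vlasov_equation_at_def by blast
  \<comment> \<open>At \<open>t = 0\<close> only a right derivative exists; on
    \<open>{t..t + 1}\<close> it is unique for every \<open>t \<ge> 0\<close>.\<close>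
  have "((\<lambda>s. f s x (v, w)) has_real_derivative ft) (at t within {t..t + 1})"
    by (rule DERIV_subset[OF ft]) (use t in auto)
  moreover have "((\<lambda>s. f s x (v, w)) has_real_derivative D (t, x, v, w) (1, 0, 0, 0)) (at t within {t..t + 1})"
    by (rule has_derivative_t) (use t in auto)
  ultimately have 1: "D (t, x, v, w) (1, 0, 0, 0) = ft"
    using vector_derivative_unique_within_closed_interval[of t "t + 1" t]
    by (auto simp: has_real_derivative_iff_has_vector_derivative)
  have 2: "D (t, x, v, w) (0, 1, 0, 0) = fx"
    by (rule DERIV_unique[OF has_derivative_x[OF t UNIV_I] fx])
  have 3: "D (t, x, v, w) (0, 0, 1, 0) = fv"
    by (rule DERIV_unique[OF has_derivative_v1[OF t UNIV_I] fv])
  have "D (t, x, v, w) ((1, 0, 0, 0) + v *\<^sub>R (0, 1, 0, 0) + E1 f t x *\<^sub>R (0, 0, 1, 0)) = 0"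
    using eq by (simp add: 1 2 3 blinfun.bilinear_simps del: add_Pair scaleR_Pair)
  then show ?thesis by simp
qed

lemma continuous_on_f:
  assumes "continuous_on S a" "continuous_on S b" "continuous_on S c" "\<And>s. s \<in> S \<Longrightarrow> 0 \<le> a s"
  shows "continuous_on S (\<lambda>s. f (a s) (b s) (c s))"
proof -
  have "continuous_on ({0..} \<times> UNIV) (\<lambda>(t, x, v). f t x v)"
    by (rule has_derivative_continuous_on[OF has_derivative_f])
  then have "continuous_on S (\<lambda>s. (\<lambda>(t, x, v). f t x v) (a s, b s, c s))"
    by (rule continuous_on_compose2) (use assms in \<open>auto intro!: continuous_intros\<close>)
  then show ?thesis by simp
qed

lemma continuous_on_D:
  assumes "continuous_on S a" "continuous_on S b" "continuous_on S c" "\<And>s. s \<in> S \<Longrightarrow> 0 \<le> a s"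
  shows "continuous_on S (\<lambda>s. D (a s, b s, c s) u)"
proof -
  have "continuous_on S (\<lambda>s. D (a s, b s, c s))"
    by (rule continuous_on_compose2[OF continuous_D]) (use assms in \<open>auto intro!: continuous_intros\<close>)
  then show ?thesis by (intro continuous_intros)
qed

text \<open>The maximum of \<open>f - e \<tau>\<close> over the cone below cannot be attained at \<open>\<tau> > 0\<close>: an Euler step
  backwards along the characteristic direction stays in the cone and increases the function. The sign
  \<open>\<sigma>\<close> selects the direction of time.\<close>

lemma support_cone:
  assumes \<sigma>: "\<sigma> = 1 \<or> \<sigma> = -1" and p: "0 \<le> p" "0 \<le> T" "0 \<le> p + \<sigma> * T" and "0 \<le> L"
    and E: "\<And>\<tau> x. 0 < \<tau> \<Longrightarrow> \<tau> \<le> T \<Longrightarrow> \<bar>E1 f (p + \<sigma> * \<tau>) x\<bar> \<le> L"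
    and nz: "f (p + \<sigma> * T) x0 (v0, w0) \<noteq> 0"
  shows "\<exists>x v. \<bar>x - x0\<bar> \<le> (\<bar>v0\<bar> + L * T) * T \<and> \<bar>v - v0\<bar> \<le> L * T \<and> f p x (v, w0) \<noteq> 0"
proof (rule ccontr)
  assume neg: "\<not> ?thesis"
  \<comment> \<open>\<open>W\<close> bounds \<open>\<bar>v\<bar>\<close> throughout the cone, as
    \<open>v\<close> stays within \<open>L * T\<close> of \<open>v0\<close>; it is therefore a
    sufficient slope in the \<open>x\<close> direction.\<close>
  define W where "W = \<bar>v0\<bar> + L * T"
  have W: "0 \<le> W" using \<open>0 \<le> L\<close> p by (simp add: W_def)
  define K where "K = {(\<tau>, x, v). 0 \<le> \<tau> \<and> \<tau> \<le> T \<and> \<bar>x - x0\<bar> \<le> W * (T - \<tau>) \<and> \<bar>v - v0\<bar> \<le> L * (T - \<tau>)}"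
  have time: "0 \<le> p + \<sigma> * \<tau>" if "0 \<le> \<tau>" "\<tau> \<le> T" for \<tau>
    using that p \<sigma> by auto
  have "closed K"
    unfolding K_def case_prod_beta
    by (intro closed_Collect_conj closed_Collect_le continuous_intros)
  moreover have "K \<subseteq> cbox (0, x0 - W * T, v0 - L * T) (T, x0 + W * T, v0 + L * T)"
  proof
    fix z assume "z \<in> K"
    then obtain \<tau> x v where z: "z = (\<tau>, x, v)" "0 \<le> \<tau>" "\<tau> \<le> T"
      "\<bar>x - x0\<bar> \<le> W * (T - \<tau>)" "\<bar>v - v0\<bar> \<le> L * (T - \<tau>)" by (auto simp: K_def)
    moreover have "W * (T - \<tau>) \<le> W * T" "L * (T - \<tau>) \<le> L * T"
      using z W \<open>0 \<le> L\<close> by (auto intro!: mult_left_mono)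
    ultimately show "z \<in> cbox (0, x0 - W * T, v0 - L * T) (T, x0 + W * T, v0 + L * T)"
      by (auto simp: abs_le_iff)
  qed
  ultimately have K: "compact K"
    by (meson bounded_cbox bounded_subset compact_eq_bounded_closed)
  have apex: "(T, x0, v0) \<in> K" using p by (simp add: K_def)
  have small: "f (p + \<sigma> * T) x0 (v0, w0) \<le> e * T" if "0 < e" for e
  proof -
    define G where "G = (\<lambda>(\<tau>, x, v). f (p + \<sigma> * \<tau>) x (v, w0) - e * \<tau>)"
    have "continuous_on K G"
      unfolding G_def case_prod_beta
      by (intro continuous_intros continuous_on_f) (auto simp: K_def time)
    then obtain z where z: "z \<in> K" "\<And>y. y \<in> K \<Longrightarrow> G y \<le> G z"
      using continuous_attains_sup[OF K] apex by blast
    obtain \<tau> x v where zz: "z = (\<tau>, x, v)" by (cases z)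
    have \<tau>: "0 \<le> \<tau>" "\<tau> \<le> T" and x: "\<bar>x - x0\<bar> \<le> W * (T - \<tau>)" and v: "\<bar>v - v0\<bar> \<le> L * (T - \<tau>)"
      using z(1) by (auto simp: zz K_def)
    have "\<tau> = 0"
    proof (rule ccontr)
      assume "\<tau> \<noteq> 0"
      define E where "E = E1 f (p + \<sigma> * \<tau>) x"
      \<comment> \<open>The field bound enters at positive \<open>\<tau>\<close> only, so the base
        time \<open>p\<close> may later be a singular time.\<close>
      have El: "\<bar>E\<bar> \<le> L" unfolding E_def using \<tau> \<open>\<tau> \<noteq> 0\<close> by (intro E) auto
      have "L * (T - \<tau>) \<le> L * T" using \<tau> \<open>0 \<le> L\<close> by (intro mult_left_mono) auto
      then have vW: "\<bar>v\<bar> \<le> W" using v by (simp add: W_def)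
      define q where "q = (\<lambda>h. (\<tau> - h, x - h * (\<sigma> * v), v - h * (\<sigma> * E)))"
      have step: "\<bar>y - h * (\<sigma> * u) - y0\<bar> \<le> B * (T - (\<tau> - h))"
        if "0 \<le> h" "\<bar>y - y0\<bar> \<le> B * (T - \<tau>)" "\<bar>u\<bar> \<le> B" for y u y0 B h
      proof -
        have "\<bar>h * (\<sigma> * u)\<bar> \<le> h * B"
          using that \<sigma> by (auto simp: abs_mult intro!: mult_left_mono)
        moreover have "B * (T - (\<tau> - h)) = B * (T - \<tau>) + h * B" by (simp add: algebra_simps)
        ultimately show ?thesis using that(2) by linarith
      qed
      have qK: "q h \<in> K" if "h \<in> {0..\<tau>}" for h
        using that step[OF _ x vW, of h] step[OF _ v El, of h] \<tau> by (auto simp: q_def K_def)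
      have "((\<lambda>h. f (p + \<sigma> * (\<tau> - h)) (x - h * (\<sigma> * v)) (v - h * (\<sigma> * E), w0)) has_real_derivative
          D (p + \<sigma> * (\<tau> - 0), x - 0 * (\<sigma> * v), v - 0 * (\<sigma> * E), w0) (-\<sigma>, -(\<sigma> * v), -(\<sigma> * E), 0)) (at 0 within {0..\<tau>})"
        by (rule has_real_derivative_path)
          (use \<tau> time in \<open>auto intro!: derivative_eq_intros\<close>)
      moreover have "D (p + \<sigma> * \<tau>, x, v, w0) (-\<sigma>, -(\<sigma> * v), -(\<sigma> * E), 0) =
          -\<sigma> * D (p + \<sigma> * \<tau>, x, v, w0) (1, v, E, 0)"
        using blinfun.scaleR_right[of "D (p + \<sigma> * \<tau>, x, v, w0)" "-\<sigma>" "(1, v, E, 0)"] by simp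
      moreover have "D (p + \<sigma> * \<tau>, x, v, w0) (1, v, E, 0) = 0"
        unfolding E_def using time \<tau> by (intro vlasov) auto
      ultimately have "((\<lambda>h. G (q h)) has_real_derivative e) (at 0 within {0..\<tau>})"
        unfolding G_def q_def by (auto intro!: derivative_eq_intros)
      from has_real_derivative_pos_inc_right[OF this \<open>0 < e\<close>] obtain d where d: "0 < d"
        "\<And>h. 0 < h \<Longrightarrow> 0 + h \<in> {0..\<tau>} \<Longrightarrow> h < d \<Longrightarrow> G (q 0) < G (q (0 + h))" by auto
      define h where "h = min \<tau> (d / 2)"
      have h: "0 < h" "h \<in> {0..\<tau>}" "h < d"
        using d(1) \<tau> \<open>\<tau> \<noteq> 0\<close> by (auto simp: h_def min_less_iff_disj)
      have "G (q 0) < G (q h)" using d(2)[of h] h by simp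
      moreover have "G (q h) \<le> G z" using z(2) qK h by blast
      ultimately show False by (simp add: q_def zz)
    qed
    then have "f p x (v, w0) = 0" using neg x v by (auto simp: W_def)
    then have "G z = 0" by (simp add: zz G_def \<open>\<tau> = 0\<close>)
    then show ?thesis using z(2)[OF apex] by (simp add: G_def)
  qed
  have pos: "0 < f (p + \<sigma> * T) x0 (v0, w0)"
    using nonneg[OF p(3), of x0 "(v0, w0)"] nz by linarith
  \<comment> \<open>The denominator makes \<open>e * T\<close> at most half the value at the apex,
    and \<open>T + 1\<close> also covers \<open>T = 0\<close>.\<close>
  define e where "e = f (p + \<sigma> * T) x0 (v0, w0) / (2 * (T + 1))"
  have "0 < e" using pos p by (simp add: e_def)
  moreover have "e * T < f (p + \<sigma> * T) x0 (v0, w0)"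
  proof -
    have "e * T \<le> e * (T + 1)" using \<open>0 < e\<close> by simp
    also have "\<dots> = f (p + \<sigma> * T) x0 (v0, w0) / 2" using p by (simp add: e_def field_simps)
    finally show ?thesis using pos by simp
  qed
  ultimately show False using small[of e] by simp
qed

end

section \<open>Velocity moments\<close>

text \<open>The inequalities are strict for the support, so that \<open>f\<close> vanishes on the boundary of the box and no
  boundary terms arise.\<close>

definition supported_in :: "(real \<Rightarrow> real \<Rightarrow> real \<times> real \<Rightarrow> real) \<Rightarrow> real \<Rightarrow> real \<Rightarrow> bool" where
  "supported_in f t R \<longleftrightarrow> (\<forall>x v w. R \<le> \<bar>x\<bar> \<or> R \<le> \<bar>v\<bar> \<or> R \<le> \<bar>w\<bar> \<longrightarrow> f t x (v, w) = 0)"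

lemma supported_inD:
  "supported_in f t R \<Longrightarrow> f t x (v, w) \<noteq> 0 \<Longrightarrow> \<bar>x\<bar> < R \<and> \<bar>v\<bar> < R \<and> \<bar>w\<bar> < R"
  unfolding supported_in_def by (meson not_le)

lemma supported_in_mono: "supported_in f t R \<Longrightarrow> R \<le> S \<Longrightarrow> supported_in f t S"
  unfolding supported_in_def by (meson order_trans)

text \<open>A fixed box makes the domain independent of all parameters, so the Leibniz rule applies,
  also to moments of \<open>D\<close>. For \<open>g = f t x\<close> supported in the box,
  \<open>p = 0, 1, 2\<close> give rho, j and k.\<close>

definition moment :: "(real \<times> real \<Rightarrow> real) \<Rightarrow> real \<Rightarrow> nat \<Rightarrow> real" where
  "moment g R p = integral (cbox (-R, -R) (R, R)) (\<lambda>v. fst v ^ p * g v)"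

lemma integrable_moment:
  "continuous_on (cbox (-R, -R) (R, R)) g \<Longrightarrow>
    (\<lambda>v. fst v ^ p * g v) integrable_on cbox (-R, -R) (R, R :: real)" for g :: "_ \<Rightarrow> real"
  by (intro integrable_continuous continuous_intros)

lemma continuous_on_moment:
  assumes "continuous_on (U \<times> cbox (-R, -R) (R, R)) (\<lambda>(s, v). g s v)"
  shows "continuous_on U (\<lambda>s. moment (g s) R p)"
  unfolding moment_def
proof (rule integral_continuous_on_param)
  have "continuous_on (U \<times> cbox (-R, -R) (R, R)) (\<lambda>z. fst (snd z) ^ p * (\<lambda>(s, v). g s v) z)"
    by (intro continuous_intros assms)
  then show "continuous_on (U \<times> cbox (-R, -R) (R, R)) (\<lambda>(s, v). fst v ^ p * g s v)"
    by (simp add: case_prod_beta)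
qed

lemma moment_has_derivative:
  assumes "\<And>s v. s \<in> I \<Longrightarrow> ((\<lambda>s. g s v) has_real_derivative g' s v) (at s within I)"
    and "\<And>s. s \<in> I \<Longrightarrow> continuous_on (cbox (-R, -R) (R, R)) (g s)"
    and "continuous_on (I \<times> cbox (-R, -R) (R, R)) (\<lambda>(s, v). g' s v)"
    and "s \<in> I" "convex I"
  shows "((\<lambda>s. moment (g s) R p) has_real_derivative moment (g' s) R p) (at s within I)"
  unfolding moment_def
proof (rule leibniz_rule_field_derivative[OF _ _ _ \<open>s \<in> I\<close> \<open>convex I\<close>])
  have "continuous_on (I \<times> cbox (-R, -R) (R, R)) (\<lambda>z. fst (snd z) ^ p * (\<lambda>(s, v). g' s v) z)"
    by (intro continuous_intros assms)
  then show "continuous_on (I \<times> cbox (-R, -R) (R, R)) (\<lambda>(s, v). fst v ^ p * g' s v)"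
    by (simp add: case_prod_beta)
qed (use assms in \<open>auto intro!: DERIV_cmult integrable_moment\<close>)

lemma moment_nonneg:
  assumes "continuous_on (cbox (-R, -R) (R, R)) g" "\<And>v. 0 \<le> g v" "even p"
  shows "0 \<le> moment g R p"
  unfolding moment_def
  by (rule integral_nonneg[OF integrable_moment]) (use assms in \<open>auto intro!: mult_nonneg_nonneg zero_le_even_power\<close>)

text \<open>The integral of \<open>(a * fst v + b)\<^sup>2 * g v\<close> is a nonnegative quadratic
  form in \<open>a\<close> and \<open>b\<close>. Taking \<open>a = m0\<close>,
  \<open>b = -m1\<close> gives the claim multiplied by \<open>m0\<close>. If \<open>m0 = 0\<close>,
  the form at \<open>a = 1\<close> is affine in \<open>b\<close>, which forces its slope to
  vanish.\<close>

lemma moment_Cauchy_Schwarz: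
  assumes g: "continuous_on (cbox (-R, -R) (R, R)) g" "\<And>v. 0 \<le> g v"
  shows "(moment g R 1)\<^sup>2 \<le> moment g R 0 * moment g R 2"
proof -
  have quad: "0 \<le> a\<^sup>2 * moment g R 2 + 2 * a * b * moment g R 1 + b\<^sup>2 * moment g R 0" for a b
  proof -
    have "((\<lambda>v. a\<^sup>2 * (fst v ^ 2 * g v) + 2 * a * b * (fst v ^ 1 * g v) + b\<^sup>2 * (fst v ^ 0 * g v))
        has_integral a\<^sup>2 * moment g R 2 + 2 * a * b * moment g R 1 + b\<^sup>2 * moment g R 0) (cbox (-R, -R) (R, R))"
      unfolding moment_def
      by (intro has_integral_add has_integral_mult_right integrable_integral integrable_moment g)
    moreover have eq: "a\<^sup>2 * (fst v ^ 2 * g v) + 2 * a * b * (fst v ^ 1 * g v) + b\<^sup>2 * (fst v ^ 0 * g v)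
        = (a * fst v + b)\<^sup>2 * g v" for v
      by (simp add: algebra_simps power2_eq_square)
    ultimately show ?thesis
      by (elim has_integral_nonneg) (simp only: eq, simp add: g(2))
  qed
  define m0 m1 m2 where "m0 = moment g R 0" and "m1 = moment g R 1" and "m2 = moment g R 2"
  have "0 \<le> m0" unfolding m0_def by (rule moment_nonneg) (use g in auto)
  show ?thesis
  proof (cases "m0 = 0")
    case False
    have "0 \<le> m0 * (m0 * m2 - m1\<^sup>2)"
      using quad[of m0 "-m1"] unfolding m0_def[symmetric] m1_def[symmetric] m2_def[symmetric]
      by (simp add: algebra_simps power2_eq_square)
    then have "m1\<^sup>2 \<le> m0 * m2" using False \<open>0 \<le> m0\<close> by (simp add: zero_le_mult_iff)
    then show ?thesis by (simp add: m0_def m1_def m2_def)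
  next
    case True
    have "0 \<le> m2 + 2 * b * m1" for b
      using quad[of 1 b] unfolding m0_def[symmetric] m1_def[symmetric] m2_def[symmetric] True by simp
    note q = this
    have "m1 = 0"
    proof (rule ccontr)
      assume "m1 \<noteq> 0"
      \<comment> \<open>This \<open>b\<close> makes the affine expression equal to -1.\<close>
      then show False using q[of "-(m2 + 1) / (2 * m1)"] by (simp add: field_simps)
    qed
    then show ?thesis using True by (simp add: m0_def m1_def)
  qed
qed

lemma integral_box_swap:
  fixes f :: "real \<times> real \<Rightarrow> real"
  assumes "continuous_on (cbox (a, c) (b, d)) f"
  shows "integral (cbox (a, c) (b, d)) f = integral {c..d} (\<lambda>y. integral {a..b} (\<lambda>x. f (x, y)))"
proof -
  have "continuous_on (cbox (a, c) (b, d)) (\<lambda>(x, y). f (x, y))" using assms by simp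
  from integral_swap_continuous[OF this] integral_prod_continuous[OF assms]
  show ?thesis by simp
qed

context vlasov_poisson
begin

lemma continuous_on_moment_f:
  assumes "continuous_on S a" "continuous_on S b" "\<And>s. s \<in> S \<Longrightarrow> 0 \<le> a s"
  shows "continuous_on S (\<lambda>s. moment (f (a s) (b s)) R p)"
  using assms
  by (intro continuous_on_moment)
    (auto simp: case_prod_beta intro!: continuous_on_f continuous_on_snd continuous_on_id
      continuous_on_compose2[of S _ "_ \<times> _" fst] continuous_on_fst)

lemma continuous_on_moment_D:
  assumes "continuous_on S a" "continuous_on S b" "\<And>s. s \<in> S \<Longrightarrow> 0 \<le> a s"
  shows "continuous_on S (\<lambda>s. moment (\<lambda>v. D (a s, b s, v) u) R p)"
  using assms
  by (intro continuous_on_moment)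
    (auto simp: case_prod_beta intro!: continuous_on_D continuous_on_snd continuous_on_id
      continuous_on_compose2[of S _ "_ \<times> _" fst] continuous_on_fst)

lemma moment_deriv_t:
  "((\<lambda>s. moment (f s x) R p) has_real_derivative moment (\<lambda>v. D (t, x, v) (1, 0, 0, 0)) R p) (at t within I)"
  if "t \<in> I" "I \<subseteq> {0..}" "convex I"
  by (rule moment_has_derivative)
    (use that in \<open>auto simp: case_prod_beta intro!: has_derivative_t continuous_on_f continuous_on_D
      continuous_on_fst continuous_on_snd continuous_on_id continuous_on_const\<close>)

lemma moment_deriv_x:
  "((\<lambda>y. moment (f t y) R p) has_real_derivative moment (\<lambda>v. D (t, x, v) (0, 1, 0, 0)) R p) (at x within I)"
  if "0 \<le> t" "x \<in> I" "convex I"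
  by (rule moment_has_derivative)
    (use that in \<open>auto simp: case_prod_beta intro!: has_derivative_x continuous_on_f
      continuous_on_D[of _ "\<lambda>_. t" fst snd, simplified] continuous_on_fst continuous_on_snd
      continuous_on_id continuous_on_const\<close>)

text \<open>Integration by parts in the first velocity component: \<open>?h\<close> is the
  derivative of \<open>v\<^sub>1 ^ p * f\<close>, which vanishes at both ends of the box. For
  \<open>p = 0\<close> the truncated exponent \<open>p - 1\<close> is harmless because of the factor
  \<open>real p\<close>.\<close>

lemma moment_deriv_v:
  assumes "0 \<le> t" "supported_in f t R" "0 < R"
  shows "moment (\<lambda>v. D (t, x, v) (0, 0, 1, 0)) R p = - real p * moment (f t x) R (p - 1)"
proof -
  let ?B = "cbox (-R, -R) (R, R) :: (real \<times> real) set"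
  let ?h = "\<lambda>v. real p * (fst v ^ (p - 1) * f t x v) + fst v ^ p * D (t, x, v) (0, 0, 1, 0)"
  have c: "continuous_on S (f t x)" "continuous_on S (\<lambda>v. D (t, x, v) u)" for S u
    using assms by (auto intro!: continuous_on_f continuous_on_D continuous_on_id continuous_on_const)
  have inner: "integral {-R..R} (\<lambda>v. ?h (v, w)) = 0" for w
  proof -
    have "((\<lambda>u. u ^ p * f t x (u, w)) has_real_derivative ?h (v, w)) (at v within {-R..R})"
      if "v \<in> {-R..R}" for v
      using that assms by (auto intro!: derivative_eq_intros has_derivative_v1)
    then have "((\<lambda>v. ?h (v, w)) has_integral R ^ p * f t x (R, w) - (-R) ^ p * f t x (-R, w)) {-R..R}"
      using \<open>0 < R\<close> by (intro fundamental_theorem_of_calculus)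
        (auto simp: has_real_derivative_iff_has_vector_derivative)
    then show ?thesis
      using assms(2) by (auto simp: supported_in_def)
  qed
  have "integral ?B ?h = integral {-R..R} (\<lambda>w. integral {-R..R} (\<lambda>v. ?h (v, w)))"
    by (intro integral_box_swap continuous_intros c)
  also have "\<dots> = 0" unfolding inner by simp
  finally have "integral ?B ?h = 0" .
  moreover have "integral ?B ?h = real p * moment (f t x) R (p - 1) + moment (\<lambda>v. D (t, x, v) (0, 0, 1, 0)) R p"
    unfolding moment_def by (intro integral_unique has_integral_add has_integral_mult_right integrable_integral integrable_moment c)
  ultimately show ?thesis by simp
qed

text \<open>The equation integrated against the \<open>p\<close>-th power of the first velocity
  component. The case \<open>p = 0\<close> is the continuity equation rho_t = -j_x, the case
  \<open>p = 1\<close> is j_t = -k_x + E1 rho.\<close>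

lemma moment_transport:
  assumes "0 \<le> t" "supported_in f t R" "0 < R"
  shows "moment (\<lambda>v. D (t, x, v) (1, 0, 0, 0)) R p =
    - moment (\<lambda>v. D (t, x, v) (0, 1, 0, 0)) R (Suc p) + E1 f t x * (real p * moment (f t x) R (p - 1))"
proof -
  have eq: "D (t, x, v) (1, 0, 0, 0) = - fst v * D (t, x, v) (0, 1, 0, 0) - E1 f t x * D (t, x, v) (0, 0, 1, 0)" for v
  proof -
    have "D (t, x, v) ((1, 0, 0, 0) + fst v *\<^sub>R (0, 1, 0, 0) + E1 f t x *\<^sub>R (0, 0, 1, 0)) = 0"
      using vlasov[OF \<open>0 \<le> t\<close>, of x "fst v" "snd v"] by simp
    then show ?thesis by (simp add: blinfun.bilinear_simps del: add_Pair scaleR_Pair)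
  qed
  have c: "continuous_on S (\<lambda>v. D (t, x, v) u)" for S u
    using assms by (auto intro!: continuous_on_D continuous_on_id continuous_on_const)
  have "((\<lambda>v. (-1) * (fst v ^ Suc p * D (t, x, v) (0, 1, 0, 0)) + (- E1 f t x) * (fst v ^ p * D (t, x, v) (0, 0, 1, 0)))
     has_integral (-1) * moment (\<lambda>v. D (t, x, v) (0, 1, 0, 0)) R (Suc p)
       + (- E1 f t x) * moment (\<lambda>v. D (t, x, v) (0, 0, 1, 0)) R p) (cbox (-R, -R) (R, R))"
    unfolding moment_def
    by (intro has_integral_add has_integral_mult_right integrable_integral integrable_moment c)
  then have "moment (\<lambda>v. D (t, x, v) (1, 0, 0, 0)) R p = (-1) * moment (\<lambda>v. D (t, x, v) (0, 1, 0, 0)) R (Suc p)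
       + (- E1 f t x) * moment (\<lambda>v. D (t, x, v) (0, 0, 1, 0)) R p"
    unfolding moment_def eq by (intro integral_unique) (simp add: algebra_simps)
  then show ?thesis by (simp add: moment_deriv_v[OF assms])
qed

lemma moment_outside:
  assumes "supported_in f t R" "R \<le> \<bar>x\<bar>"
  shows "moment (f t x) R p = 0"
proof -
  have "f t x v = 0" for v using assms by (cases v) (auto simp: supported_in_def)
  then show ?thesis by (simp add: moment_def)
qed

end

section \<open>Mass and electric field\<close>

text \<open>Substituting \<open>a + s * (x - a)\<close> for the integration variable moves the
  endpoint \<open>x\<close> into the integrand; continuity of parameter integrals over the fixed
  interval \<open>{0..1}\<close> then handles both variables at once.\<close>

lemma continuous_on_indefinite_integral:
  fixes g :: "'a::topological_space \<Rightarrow> real \<Rightarrow> real"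
  assumes g: "continuous_on (T \<times> {a..b}) (\<lambda>(t, x). g t x)"
  shows "continuous_on (T \<times> {a..b}) (\<lambda>(t, x). integral {a..x} (g t))"
proof -
  have comp: "continuous_on S (\<lambda>z. g (u z) (v z))"
    if "continuous_on S u" "continuous_on S v" "\<And>z. z \<in> S \<Longrightarrow> u z \<in> T \<and> v z \<in> {a..b}"
    for S :: "'c::topological_space set" and u v
  proof -
    have "continuous_on S (\<lambda>z. (\<lambda>(t, x). g t x) (u z, v z))"
      by (rule continuous_on_compose2[OF g continuous_on_Pair[OF that(1,2)]]) (use that(3) in force)
    then show ?thesis by simp
  qed
  have seg: "a + s * (x - a) \<in> {a..x}" if "s \<in> {0..1}" "x \<in> {a..b}" for s x
  proof -
    have "s * (x - a) \<le> 1 * (x - a)" using that by (intro mult_right_mono) auto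
    then show ?thesis using that by auto
  qed
  have sub: "integral {a..x} (g t) = integral {0..1} (\<lambda>s. (x - a) * g t (a + s * (x - a)))"
    if tx: "t \<in> T" "x \<in> {a..b}" for t x
  proof -
    let ?G = "\<lambda>s. integral {a..a + s * (x - a)} (g t)"
    have gt: "continuous_on {a..x} (g t)" using tx by (intro comp continuous_on_const continuous_on_id) auto
    have "(?G has_real_derivative (x - a) * g t (a + s * (x - a))) (at s within {0..1})" if s: "s \<in> {0..1}" for s
    proof -
      have "((\<lambda>y. integral {a..y} (g t)) has_real_derivative g t (a + s * (x - a)))
          (at (a + s * (x - a)) within (\<lambda>s. a + s * (x - a)) ` {0..1})"
        by (rule DERIV_subset[OF integral_has_real_derivative[OF gt]]) (use seg[OF _ tx(2)] s in auto)
      moreover have "((\<lambda>s. a + s * (x - a)) has_real_derivative x - a) (at s within {0..1})"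
        by (auto intro!: derivative_eq_intros)
      ultimately show ?thesis
        using DERIV_image_chain by (fastforce simp: o_def mult.commute)
    qed
    then have "((\<lambda>s. (x - a) * g t (a + s * (x - a))) has_integral ?G 1 - ?G 0) {0..1}"
      by (intro fundamental_theorem_of_calculus) (auto simp: has_real_derivative_iff_has_vector_derivative)
    then have "((\<lambda>s. (x - a) * g t (a + s * (x - a))) has_integral integral {a..x} (g t)) {0..1}"
      by simp
    then show ?thesis by (rule integral_unique[symmetric])
  qed
  have "continuous_on (T \<times> {a..b}) (\<lambda>z. integral (cbox 0 1) (\<lambda>s. (snd z - a) * g (fst z) (a + s * (snd z - a))))"
  proof (rule integral_continuous_on_param)
    have "a + s * (x - a) \<in> {a..b}" if "s \<in> {0..1}" "x \<in> {a..b}" for s x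
      using seg[OF that] that by auto
    then have "continuous_on ((T \<times> {a..b}) \<times> {0..1::real})
        (\<lambda>z. (snd (fst z) - a) * g (fst (fst z)) (a + snd z * (snd (fst z) - a)))"
      by (intro continuous_on_mult comp continuous_intros) auto
    then show "continuous_on ((T \<times> {a..b}) \<times> cbox 0 1)
        (\<lambda>(z, s). (snd z - a) * g (fst z) (a + s * (snd z - a)))"
      by (simp add: case_prod_beta)
  qed
  then show ?thesis
    by (rule continuous_on_eq) (auto simp: sub)
qed

lemma set_lebesgue_integral_eq_integral_Icc:
  fixes g :: "real \<Rightarrow> real"
  assumes "continuous_on {a..b} g" "\<And>y. y \<in> S \<Longrightarrow> y \<notin> {a..b} \<Longrightarrow> g y = 0" "\<And>y. y \<in> {a..b} \<Longrightarrow> y \<notin> S \<Longrightarrow> g y = 0"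
  shows "(LINT y:S|lborel. g y) = integral {a..b} g"
proof -
  have "(\<lambda>y. indicator S y *\<^sub>R g y) = (\<lambda>y. indicator {a..b} y *\<^sub>R g y)"
    using assms(2,3) by (auto simp: indicator_def fun_eq_iff)
  then have "(LINT y:S|lborel. g y) = (LINT y:{a..b}|lborel. g y)"
    by (simp add: set_lebesgue_integral_def)
  also have "\<dots> = integral {a..b} g"
    using assms(1) by (intro set_borel_integral_eq_integral borel_integrable_atLeastAtMost')
  finally show ?thesis .
qed

context vlasov_poisson
begin

lemma rho_eq_moment:
  assumes "0 \<le> t" "supported_in f t R" "0 < R"
  shows "rho f t x = moment (f t x) R 0"
proof -
  let ?B = "cbox (-R, -R) (R, R) :: (real \<times> real) set"
  have zero: "f t x v = 0" if "v \<notin> ?B" for v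
  proof (rule ccontr)
    assume "f t x v \<noteq> 0"
    then show False using that supported_inD[OF assms(2), of x "fst v" "snd v"] by (cases v) auto
  qed
  have "f t x v = indicator ?B v *\<^sub>R f t x v" for v
    by (cases "v \<in> ?B") (simp_all add: zero)
  then have "(\<lambda>v. f t x v) = (\<lambda>v. indicator ?B v *\<^sub>R f t x v)"
    by (rule ext)
  then have "rho f t x = (LINT v:?B|lborel. f t x v)"
    unfolding rho_def set_lebesgue_integral_def by (rule arg_cong)
  also have "\<dots> = integral ?B (f t x)"
  proof (rule set_borel_integral_eq_integral)
    show "set_integrable lborel ?B (f t x)"
      unfolding set_integrable_def using assms
      by (intro borel_integrable_compact) (auto intro!: continuous_on_f continuous_on_id continuous_on_const)
  qed
  finally show ?thesis by (simp add: moment_def)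
qed

text \<open>Stated without a support box, so that times with different support bounds can be
  compared.\<close>

definition mass :: "real \<Rightarrow> real" where
  "mass t = (LINT y|lborel. rho f t y)"

context
  fixes t R
  assumes t: "0 \<le> t" and R: "0 < R" and supp: "supported_in f t R"
begin

lemma continuous_on_rho: "continuous_on S (rho f t)"
  using continuous_on_moment_f[of S "\<lambda>_. t" "\<lambda>x. x" R 0] t
  by (simp add: rho_eq_moment[OF t supp R] continuous_on_id)

lemma rho_outside: "R \<le> \<bar>x\<bar> \<Longrightarrow> rho f t x = 0"
  by (simp add: rho_eq_moment[OF t supp R] moment_outside[OF supp])

lemma rho_nonneg: "0 \<le> rho f t x"
  unfolding rho_eq_moment[OF t supp R]
  using t by (intro moment_nonneg) (auto intro!: continuous_on_f continuous_on_id continuous_on_const nonneg)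

lemma mass_eq_integral: "mass t = integral {-R..R} (rho f t)"
proof -
  have "mass t = (LINT y:UNIV|lborel. rho f t y)"
    by (simp add: mass_def set_lebesgue_integral_def)
  also have "\<dots> = integral {-R..R} (rho f t)"
    by (intro set_lebesgue_integral_eq_integral_Icc continuous_on_rho) (auto intro!: rho_outside)
  finally show ?thesis .
qed

lemma integral_rho_split:
  assumes "-R \<le> c" "c \<le> R"
  shows "integral {-R..c} (rho f t) + integral {c..R} (rho f t) = mass t"
  unfolding mass_eq_integral
  by (rule Henstock_Kurzweil_Integration.integral_combine[OF assms integrable_continuous_real[OF continuous_on_rho]])

lemma integral_rho_nonneg: "0 \<le> integral {c..d} (rho f t)"
  by (intro integral_nonneg integrable_continuous_real continuous_on_rho rho_nonneg)

text \<open>Beyond the box the half-line integrals no longer change, so \<open>x\<close> may be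
  replaced by the nearest point of \<open>{-R..R}\<close>; this also gives the field bound for all
  \<open>x\<close>.\<close>

lemma E1_eq_clamp:
  defines "c \<equiv> \<lambda>x. max (-R) (min R x)"
  shows "E1 f t x = integral {-R..c x} (rho f t) - mass t / 2"
proof -
  have "(LINT y:{..x}|lborel. rho f t y) = integral {-R..c x} (rho f t)"
    using R by (intro set_lebesgue_integral_eq_integral_Icc continuous_on_rho)
      (auto simp: c_def intro!: rho_outside)
  moreover have "(LINT y:{x..}|lborel. rho f t y) = integral {c x..R} (rho f t)"
    using R by (intro set_lebesgue_integral_eq_integral_Icc continuous_on_rho)
      (auto simp: c_def max_def min_def intro!: rho_outside split: if_splits)
  moreover have "integral {-R..c x} (rho f t) + integral {c x..R} (rho f t) = mass t"
    using R by (intro integral_rho_split) (auto simp: c_def)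
  ultimately show ?thesis by (simp add: E1_def algebra_simps)
qed

lemma E1_eq:
  assumes "x \<in> {-R..R}"
  shows "E1 f t x = integral {-R..x} (rho f t) - mass t / 2"
proof -
  have "max (-R) (min R x) = x" using assms by (auto simp: max_def min_def)
  then show ?thesis using E1_eq_clamp[of x] by simp
qed

lemma abs_E1_le: "\<bar>E1 f t x\<bar> \<le> mass t / 2"
proof -
  define c where "c = max (-R) (min R x)"
  have "integral {-R..c} (rho f t) + integral {c..R} (rho f t) = mass t"
    using R by (intro integral_rho_split) (auto simp: c_def)
  then show ?thesis
    using E1_eq_clamp[of x] integral_rho_nonneg[of "-R" c] integral_rho_nonneg[of c R]
    unfolding c_def[symmetric] by linarith
qed

lemma mass_nonneg: "0 \<le> mass t"
  unfolding mass_eq_integral by (rule integral_rho_nonneg)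

lemma mass_pos:
  assumes "f t x v \<noteq> 0"
  shows "0 < mass t"
proof (rule ccontr)
  assume "\<not> 0 < mass t"
  then have "integral {-R..R} (rho f t) = 0" using mass_nonneg by (simp add: mass_eq_integral)
  moreover have x: "x \<in> {-R..R}" and v: "v \<in> cbox (-R, -R) (R, R)"
    using supported_inD[OF supp, of x "fst v" "snd v"] assms by (cases v; auto)+
  ultimately have "rho f t x = 0"
    using integral_eq_0_iff[OF continuous_on_rho, of "-R" R] R rho_nonneg by auto
  then have i0: "integral (cbox (-R, -R) (R, R)) (f t x) = 0"
    by (simp add: rho_eq_moment[OF t supp R] moment_def)
  have c: "continuous_on (cbox (-R, -R) (R, R)) (f t x)"
    using t by (auto intro!: continuous_on_f continuous_on_id continuous_on_const)
  have i: "(f t x has_integral 0) (cbox (-R, -R) (R, R))"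
    using integrable_integral[OF integrable_continuous[OF c]] i0 by simp
  have "f t x v = 0"
    by (rule has_integral_0_cbox_imp_0[OF c _ i _ v]) (use R t nonneg in \<open>auto simp: box_ne_empty Basis_prod_def\<close>)
  then show False using assms by simp
qed

end

end

section \<open>Mass conservation and growth of the drift on a time interval with a common support
  box\<close>

locale vlasov_poisson_slab = vlasov_poisson +
  fixes a b R :: real
  assumes slab: "0 \<le> a" "a \<le> b" "0 < R" and supp: "t \<in> {a..b} \<Longrightarrow> supported_in f t R"
begin

lemma slab_time: "t \<in> {a..b} \<Longrightarrow> 0 \<le> t"
  using slab by auto

text \<open>The continuity equation integrated in space: mass to the left of \<open>x\<close>
  changes only by the flux through \<open>x\<close>, the flux at \<open>-R\<close> being zero. At
  \<open>x = R\<close> this yields conservation of mass, and for general \<open>x\<close> it is E1_t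
  = -j.\<close>

lemma cumulative_mass_deriv_t:
  assumes x: "x \<in> {-R..R}" and t: "t \<in> {a..b}"
  shows "((\<lambda>t. integral {-R..x} (rho f t)) has_real_derivative - moment (f t x) R 1) (at t within {a..b})"
proof -
  let ?Dt = "\<lambda>t y. moment (\<lambda>v. D (t, y, v) (1, 0, 0, 0)) R 0"
  let ?Dx = "\<lambda>y. moment (\<lambda>v. D (t, y, v) (0, 1, 0, 0)) R 1"
  have "continuous_on ({a..b} \<times> {-R..x}) (\<lambda>z. ?Dt (fst z) (snd z))"
    by (intro continuous_on_moment_D continuous_intros) (auto intro: slab_time)
  then have "((\<lambda>t. integral (cbox (-R) x) (\<lambda>y. moment (f t y) R 0)) has_real_derivative integral (cbox (-R) x) (?Dt t))
      (at t within {a..b})"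
    using t slab
    by (intro leibniz_rule_field_derivative integrable_continuous continuous_on_moment_f moment_deriv_t)
      (auto simp: case_prod_beta continuous_on_id slab_time)
  then have "((\<lambda>t. integral {-R..x} (\<lambda>y. moment (f t y) R 0)) has_real_derivative integral {-R..x} (?Dt t))
      (at t within {a..b})" by simp
  then have 1: "((\<lambda>t. integral {-R..x} (rho f t)) has_real_derivative integral {-R..x} (?Dt t))
      (at t within {a..b})"
    by (rule has_field_derivative_transform_within[OF _ zero_less_one t])
      (auto intro!: integral_cong simp: rho_eq_moment[OF slab_time supp slab(3)])
  have "?Dt t y = - ?Dx y" for y
    using moment_transport[OF slab_time[OF t] supp[OF t] slab(3), of y 0] by simp
  moreover have "(?Dx has_integral moment (f t x) R 1 - moment (f t (-R)) R 1) {-R..x}"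
    using x slab_time[OF t] by (intro fundamental_theorem_of_calculus)
      (auto simp: has_real_derivative_iff_has_vector_derivative[symmetric] intro!: moment_deriv_x)
  moreover have "moment (f t (-R)) R 1 = 0" by (rule moment_outside[OF supp[OF t]]) simp
  ultimately have "integral {-R..x} (?Dt t) = - moment (f t x) R 1"
    using integral_unique by force
  then show ?thesis using 1 by simp
qed

lemma mass_constant:
  assumes "t \<in> {a..b}" "s \<in> {a..b}"
  shows "mass t = mass s"
proof -
  have "((\<lambda>t. integral {-R..R} (rho f t)) has_real_derivative 0) (at t within {a..b})" if "t \<in> {a..b}" for t
    using cumulative_mass_deriv_t[of R t] moment_outside[OF supp[OF that], of R 1] that slab by simp
  then have "\<exists>c. \<forall>t\<in>{a..b}. integral {-R..R} (rho f t) = c"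
    by (intro has_field_derivative_zero_constant) auto
  then obtain c where "\<And>t. t \<in> {a..b} \<Longrightarrow> integral {-R..R} (rho f t) = c" by blast
  then show ?thesis using assms mass_eq_integral[OF slab_time slab(3) supp] by simp
qed

text \<open>With the mass frozen at time \<open>a\<close>, the integral is the only term that varies
  in time; agreement with \<open>E1\<close> on the slab rests on conservation of mass.\<close>

definition E :: "real \<Rightarrow> real \<Rightarrow> real" where
  "E t x = integral {-R..x} (rho f t) - mass a / 2"

lemma E1_eq_E: "E1 f t x = E t x" if "t \<in> {a..b}" "x \<in> {-R..R}"
  using E1_eq[OF slab_time slab(3) supp] mass_constant[of t a] that slab by (simp add: E_def)

lemma continuous_on_E: "continuous_on ({a..b} \<times> {-R..R}) (\<lambda>(t, x). E t x)"
proof -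
  have "continuous_on ({a..b} \<times> {-R..R}) (\<lambda>(t, x). integral {-R..x} (\<lambda>y. moment (f t y) R 0))"
    by (rule continuous_on_indefinite_integral)
      (auto simp: case_prod_beta slab_time intro!: continuous_on_moment_f continuous_intros)
  then have "continuous_on ({a..b} \<times> {-R..R}) (\<lambda>(t, x). integral {-R..x} (rho f t))"
    by (rule continuous_on_eq) (auto intro!: integral_cong simp: rho_eq_moment[OF slab_time supp slab(3)])
  then show ?thesis unfolding E_def case_prod_beta by (intro continuous_intros)
qed

lemma continuous_on_E_slice: "continuous_on {-R..R} (E t)" if "t \<in> {a..b}"
proof -
  have "continuous_on {-R..R} (\<lambda>x. (\<lambda>(t, x). E t x) (t, x))"
    by (rule continuous_on_compose2[OF continuous_on_E]) (use that in \<open>auto intro!: continuous_intros\<close>)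
  then show ?thesis by simp
qed

lemma E_deriv_t:
  "x \<in> {-R..R} \<Longrightarrow> t \<in> {a..b} \<Longrightarrow> ((\<lambda>t. E t x) has_real_derivative - moment (f t x) R 1) (at t within {a..b})"
  unfolding E_def by (auto intro!: derivative_eq_intros cumulative_mass_deriv_t)

lemma E_deriv_x:
  "x \<in> {-R..R} \<Longrightarrow> t \<in> {a..b} \<Longrightarrow> (E t has_real_derivative moment (f t x) R 0) (at x within {-R..R})"
  unfolding E_def
  using integral_has_real_derivative[OF continuous_on_rho[OF slab_time slab(3) supp]]
  by (auto intro!: derivative_eq_intros simp: rho_eq_moment[OF slab_time supp slab(3), symmetric])

text \<open>This is the functional A; the box suffices because the current j vanishes outside
  it.\<close>

definition drift :: "real \<Rightarrow> real" where
  "drift t = integral {-R..R} (\<lambda>x. E t x * moment (f t x) R 1)"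

lemma drift_deriv:
  assumes t: "t \<in> {a..b}"
  shows "\<exists>d \<ge> mass a ^ 3 / 12. (drift has_real_derivative d) (at t within {a..b})"
proof -
  let ?Dt = "\<lambda>t x. moment (\<lambda>v. D (t, x, v) (1, 0, 0, 0)) R 1"
  let ?Dx = "\<lambda>t x. moment (\<lambda>v. D (t, x, v) (0, 1, 0, 0)) R 2"
  let ?m = "\<lambda>t x p. moment (f t x) R p"
  let ?g = "\<lambda>t x. - ?m t x 1 * ?m t x 1 + ?Dt t x * E t x"
  have cg: "continuous_on ({a..b} \<times> {-R..R}) (\<lambda>(t, x). ?g t x)"
    using continuous_on_E unfolding case_prod_beta
    by (intro continuous_on_add continuous_on_mult continuous_on_minus continuous_on_moment_f
        continuous_on_moment_D continuous_on_fst continuous_on_snd continuous_on_id) (auto intro: slab_time)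
  have "((\<lambda>t. integral (cbox (-R) R) (\<lambda>x. E t x * ?m t x 1)) has_real_derivative integral (cbox (-R) R) (?g t))
      (at t within {a..b})"
  proof (rule leibniz_rule_field_derivative[OF _ _ _ t])
    show "((\<lambda>t. E t x * ?m t x 1) has_real_derivative ?g t x) (at t within {a..b})"
      if "t \<in> {a..b}" "x \<in> cbox (-R) R" for t x
      using DERIV_mult[OF E_deriv_t moment_deriv_t] that slab by auto
    show "(\<lambda>x. E t x * ?m t x 1) integrable_on cbox (-R) R" if "t \<in> {a..b}" for t
      using that by (intro integrable_continuous continuous_on_mult continuous_on_moment_f)
        (auto simp: slab_time continuous_on_id continuous_on_E_slice)
  qed (use cg in auto)
  then have "(drift has_real_derivative integral {-R..R} (?g t)) (at t within {a..b})"
    by (simp add: drift_def[abs_def])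
  moreover have "mass a ^ 3 / 12 \<le> integral {-R..R} (?g t)"
  proof -
    \<comment> \<open>The primitive \<open>?P\<close> does the integration by parts and the exact
      term E^3/3 together. Its derivative \<open>?p\<close> falls short of \<open>?g t\<close> by
      exactly rho k - j^2, and at the ends k vanishes while \<open>E\<close> equals plus or minus
      half the mass.\<close>
    let ?P = "\<lambda>x. E t x ^ 3 / 3 - E t x * ?m t x 2"
    let ?p = "\<lambda>x. (E t x)\<^sup>2 * ?m t x 0 - (?m t x 0 * ?m t x 2 + ?Dx t x * E t x)"
    have "(?P has_real_derivative ?p x) (at x within {-R..R})" if x: "x \<in> {-R..R}" for x
      using t slab_time[OF t] x
      by (intro DERIV_diff DERIV_mult E_deriv_x moment_deriv_x)
        (auto intro!: derivative_eq_intros E_deriv_x)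
    then have "(?p has_integral ?P R - ?P (-R)) {-R..R}"
      using slab by (intro fundamental_theorem_of_calculus)
        (auto simp: has_real_derivative_iff_has_vector_derivative[symmetric])
    moreover have "?m t R 2 = 0" "?m t (-R) 2 = 0"
      using moment_outside[OF supp[OF t]] by auto
    moreover have "E t R = mass a / 2"
      using mass_constant[OF t, of a] mass_eq_integral[OF slab_time[OF t] slab(3) supp[OF t]] slab by (simp add: E_def)
    moreover have "E t (-R) = - mass a / 2" by (simp add: E_def)
    ultimately have p: "(?p has_integral mass a ^ 3 / 12) {-R..R}"
      by (simp add: power3_eq_cube mult_ac)
    moreover have "(?g t has_integral integral {-R..R} (?g t)) {-R..R}"
    proof (intro integrable_integral integrable_continuous_real)
      show "continuous_on {-R..R} (?g t)"
        by (intro continuous_on_add continuous_on_mult continuous_on_minus continuous_on_moment_f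
            continuous_on_moment_D continuous_on_E_slice continuous_on_const continuous_on_id t slab_time[OF t])
    qed
    moreover have "?p x \<le> ?g t x" if x: "x \<in> {-R..R}" for x
    proof -
      have eq: "?Dt t x = - ?Dx t x + E t x * ?m t x 0"
        using moment_transport[OF slab_time[OF t] supp[OF t] slab(3), of x 1] E1_eq_E[OF t x] by (simp add: numeral_2_eq_2)
      have "?Dt t x * E t x = (E t x)\<^sup>2 * ?m t x 0 - ?Dx t x * E t x"
        unfolding eq by (simp add: algebra_simps power2_eq_square)
      moreover have "(?m t x 1)\<^sup>2 \<le> ?m t x 0 * ?m t x 2"
        using slab_time[OF t]
        by (intro moment_Cauchy_Schwarz) (auto intro!: continuous_on_f continuous_on_id continuous_on_const nonneg)
      ultimately show ?thesis by (simp add: power2_eq_square)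
    qed
    ultimately show ?thesis by (rule has_integral_le)
  qed
  ultimately show ?thesis by blast
qed

lemma drift_growth: "(b - a) * mass a ^ 3 / 12 \<le> drift b - drift a"
proof -
  obtain d where d: "\<And>t. t \<in> {a..b} \<Longrightarrow> mass a ^ 3 / 12 \<le> d t"
    "\<And>t. t \<in> {a..b} \<Longrightarrow> (drift has_real_derivative d t) (at t within {a..b})"
    using drift_deriv by metis
  have "\<exists>t\<in>{a..b}. drift b - drift a = d t * (b - a)"
    using d(2) slab by (intro mvt_very_simple) (auto simp: has_field_derivative_def)
  then obtain t where "t \<in> {a..b}" "drift b - drift a = d t * (b - a)" by blast
  moreover have "mass a ^ 3 / 12 * (b - a) \<le> d t * (b - a)"
    using d(1)[OF \<open>t \<in> {a..b}\<close>] slab by (intro mult_right_mono) auto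
  ultimately show ?thesis by (simp add: algebra_simps)
qed

text \<open>The current is at most \<open>q\<close> times the density and the field at most half the
  mass; integrating the density supplies the second factor of mass.\<close>

lemma abs_drift_le:
  assumes t: "t \<in> {a..b}" and Q: "\<And>x v w. f t x (v, w) \<noteq> 0 \<Longrightarrow> \<bar>v\<bar> \<le> q"
  shows "\<bar>drift t\<bar> \<le> q * (mass a)\<^sup>2 / 2"
proof -
  note t0 = slab_time[OF t] note st = supp[OF t] note R = slab(3)
  have c: "continuous_on S (f t x)" for S x
    using t0 by (auto intro!: continuous_on_f continuous_on_id continuous_on_const)
  have m: "mass t = mass a" using mass_constant[OF t, of a] slab by simp
  have j: "\<bar>moment (f t x) R 1\<bar> \<le> q * rho f t x" for x
  proof -
    have "norm (moment (f t x) R 1) \<le> integral (cbox (-R, -R) (R, R)) (\<lambda>v. q * (fst v ^ 0 * f t x v))"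
      unfolding moment_def
    proof (rule integral_norm_bound_integral)
      fix v :: "real \<times> real"
      show "norm (fst v ^ 1 * f t x v) \<le> q * (fst v ^ 0 * f t x v)"
        using Q[of x "fst v" "snd v"] nonneg[OF t0, of x v]
        by (cases "f t x v = 0") (auto simp: abs_mult intro!: mult_right_mono)
    qed (intro integrable_moment c integrable_on_mult_right)+
    also have "\<dots> = q * rho f t x"
      by (simp add: rho_eq_moment[OF t0 st R] moment_def)
    finally show ?thesis by simp
  qed
  have "norm (drift t) \<le> integral {-R..R} (\<lambda>x. mass a / 2 * q * rho f t x)"
    unfolding drift_def
  proof (rule integral_norm_bound_integral)
    show "(\<lambda>x. E t x * moment (f t x) R 1) integrable_on {-R..R}"
      using t0 by (intro integrable_continuous_real continuous_on_mult continuous_on_moment_f continuous_on_E_slice t) (auto simp: continuous_on_id)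
    show "(\<lambda>x. mass a / 2 * q * rho f t x) integrable_on {-R..R}"
      by (intro integrable_continuous_real continuous_on_mult continuous_on_const continuous_on_rho[OF t0 R st])
    fix x assume x: "x \<in> {-R..R}"
    have "\<bar>E t x\<bar> \<le> mass a / 2"
      using abs_E1_le[OF t0 R st, of x] E1_eq_E[OF t x] m by simp
    then have "\<bar>E t x\<bar> * \<bar>moment (f t x) R 1\<bar> \<le> (mass a / 2) * (q * rho f t x)"
      using j[of x] by (intro mult_mono) auto
    then show "norm (E t x * moment (f t x) R 1) \<le> mass a / 2 * q * rho f t x"
      by (simp add: abs_mult)
  qed
  also have "\<dots> = mass a / 2 * q * mass t"
    unfolding mass_eq_integral[OF t0 R st] by simp
  finally show ?thesis by (simp add: m power2_eq_square mult_ac)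
qed

end

context vlasov_poisson
begin

lemma ex_supported_in:
  assumes "0 \<le> t"
  shows "\<exists>R > 0. supported_in f t R"
proof -
  let ?N = "{z. (\<lambda>(x, v). f t x v) z \<noteq> 0}"
  have "bounded ?N"
    using compactly_supported_f[OF assms] unfolding compactly_supported_def
    by (meson bounded_subset closure_subset compact_imp_bounded)
  then obtain B where B: "0 < B" "\<And>z. z \<in> ?N \<Longrightarrow> norm z \<le> B"
    unfolding bounded_pos by blast
  \<comment> \<open>The added 1 turns the bound on the norm into the strict inequalities that
    \<open>supported_in\<close> encodes.\<close>
  have "\<bar>x\<bar> < B + 1 \<and> \<bar>v\<bar> < B + 1 \<and> \<bar>w\<bar> < B + 1" if "f t x (v, w) \<noteq> 0" for x v w
  proof -
    have "norm (x, v, w) \<le> B" using B(2)[of "(x, v, w)"] that by auto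
    moreover have "\<bar>x\<bar> \<le> norm (x, v, w)" "norm (v, w) \<le> norm (x, v, w)" "\<bar>v\<bar> \<le> norm (v, w)" "\<bar>w\<bar> \<le> norm (v, w)"
      using norm_fst_le[of x "(v, w)"] norm_snd_le[of "(v, w)" x] norm_fst_le[of v w] norm_snd_le[of w v] by auto
    ultimately show ?thesis by linarith
  qed
  then have "supported_in f t (B + 1)" unfolding supported_in_def by (meson not_le)
  then show ?thesis using B(1) by (intro exI[of _ "B + 1"]) auto
qed

lemma mass_constant_on:
  assumes "0 \<le> a" "0 < R" "\<And>t. t \<in> {a..b} \<Longrightarrow> supported_in f t R" "s \<in> {a..b}" "t \<in> {a..b}"
  shows "mass s = mass t"
proof -
  interpret vlasov_poisson_slab f D a b R
    using assms by unfold_locales auto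
  show ?thesis using mass_constant assms by blast
qed

section \<open>Locally uniform support\<close>

text \<open>From a box of size \<open>n\<close>, velocities reach at most \<open>n + L * T\<close>.
  The cone then has slope at most \<open>n + 2 * L * T\<close> in space, so positions reach at most
  \<open>n + (n + 2 * L * T) * T\<close>. Adding \<open>L * T\<close> to the latter dominates
  both.\<close>

definition spread :: "real \<Rightarrow> real \<Rightarrow> real \<Rightarrow> real" where
  "spread n L T = n + (n + 2 * L * T) * T + L * T"

lemma spread_mono:
  "0 \<le> n \<Longrightarrow> 0 \<le> L \<Longrightarrow> L \<le> L' \<Longrightarrow> 0 \<le> T \<Longrightarrow> T \<le> T' \<Longrightarrow> spread n L T \<le> spread n L' T'"
  unfolding spread_def by (intro add_mono mult_mono order_refl) auto

lemma supported_in_spread: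
  assumes \<sigma>: "\<sigma> = 1 \<or> \<sigma> = -1" and p: "0 \<le> p" "0 \<le> T" "0 \<le> p + \<sigma> * T" and "0 \<le> L"
    and E: "\<And>\<tau> x. 0 < \<tau> \<Longrightarrow> \<tau> \<le> T \<Longrightarrow> \<bar>E1 f (p + \<sigma> * \<tau>) x\<bar> \<le> L"
    and n: "0 < n" "supported_in f p n"
  shows "supported_in f (p + \<sigma> * T) (spread n L T)"
proof -
  have "\<bar>x0\<bar> < spread n L T \<and> \<bar>v0\<bar> < spread n L T \<and> \<bar>w0\<bar> < spread n L T"
    if nz: "f (p + \<sigma> * T) x0 (v0, w0) \<noteq> 0" for x0 v0 w0
  proof -
    obtain x v where xv: "\<bar>x - x0\<bar> \<le> (\<bar>v0\<bar> + L * T) * T" "\<bar>v - v0\<bar> \<le> L * T" "f p x (v, w0) \<noteq> 0"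
      using support_cone[OF \<sigma> p \<open>0 \<le> L\<close> E nz] by blast
    have b: "\<bar>x\<bar> < n" "\<bar>v\<bar> < n" "\<bar>w0\<bar> < n" using supported_inD[OF n(2) xv(3)] by auto
    have LT: "0 \<le> L * T" using \<open>0 \<le> L\<close> p by simp
    have "\<bar>v0\<bar> + L * T \<le> n + 2 * L * T" using b xv(2) by linarith
    then have "(\<bar>v0\<bar> + L * T) * T \<le> (n + 2 * L * T) * T" using p by (intro mult_right_mono)
    moreover have "0 \<le> (n + 2 * L * T) * T" using LT n p by simp
    ultimately show ?thesis using b xv LT unfolding spread_def by linarith
  qed
  then show ?thesis unfolding supported_in_def by (meson not_le)
qed

text \<open>The bounds in \<open>unif\<close> may blow up as \<open>\<tau>\<close> tends to 0, yet
  mass is constant on each \<open>{\<tau>..T}\<close>, so the field is bounded uniformly for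
  \<open>\<tau> > 0\<close>. The cone then bounds the support down to the base time, and the result
  depends only on data at \<open>p\<close>.\<close>

lemma supported_in_spread_mass:
  assumes \<sigma>: "\<sigma> = 1 \<or> \<sigma> = -1" and p: "0 \<le> p" "0 < T" "0 \<le> p + \<sigma> * T"
    and unif: "\<And>\<tau>. 0 < \<tau> \<Longrightarrow> \<tau> \<le> T \<Longrightarrow> \<exists>R > 0. \<forall>s\<in>{\<tau>..T}. supported_in f (p + \<sigma> * s) R"
    and n: "0 < n" "supported_in f p n"
  shows "supported_in f (p + \<sigma> * T) (spread n (mass p / 2) T)"
proof -
  let ?t = "p + \<sigma> * T"
  have time: "0 \<le> p + \<sigma> * \<tau>" if "0 \<le> \<tau>" "\<tau> \<le> T" for \<tau>
    using that p \<sigma> by auto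
  have const: "mass (p + \<sigma> * \<tau>) = mass ?t"
    if \<tau>: "0 \<le> \<tau>" "\<tau> \<le> T" and R: "0 < R" "\<And>s. s \<in> {\<tau>..T} \<Longrightarrow> supported_in f (p + \<sigma> * s) R" for \<tau> R
  proof (rule mass_constant_on[where a = "min (p + \<sigma> * \<tau>) ?t" and b = "max (p + \<sigma> * \<tau>) ?t"])
    show "0 \<le> min (p + \<sigma> * \<tau>) ?t" using time[OF \<tau>] p by auto
    show "supported_in f s R" if "s \<in> {min (p + \<sigma> * \<tau>) ?t..max (p + \<sigma> * \<tau>) ?t}" for s
    proof -
      have "\<sigma> * (s - p) \<in> {\<tau>..T}" using \<sigma> that \<tau> by (auto simp: min_def max_def split: if_splits)
      moreover have "p + \<sigma> * (\<sigma> * (s - p)) = s" using \<sigma> by auto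
      ultimately show ?thesis using R(2)[of "\<sigma> * (s - p)"] by simp
    qed
  qed (use R in auto)
  have E: "\<bar>E1 f (p + \<sigma> * \<tau>) x\<bar> \<le> mass ?t / 2" if \<tau>: "0 < \<tau>" "\<tau> \<le> T" for \<tau> x
  proof -
    obtain R where R: "0 < R" "\<And>s. s \<in> {\<tau>..T} \<Longrightarrow> supported_in f (p + \<sigma> * s) R"
      using unif[OF \<tau>] by auto
    have "mass (p + \<sigma> * \<tau>) = mass ?t" by (rule const[OF _ _ R]) (use \<tau> in auto)
    moreover have "\<bar>E1 f (p + \<sigma> * \<tau>) x\<bar> \<le> mass (p + \<sigma> * \<tau>) / 2"
      by (rule abs_E1_le[OF time R(1) R(2)]) (use \<tau> in auto)
    ultimately show ?thesis by simp
  qed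
  have m: "0 \<le> mass ?t"
    using ex_supported_in[OF p(3)] mass_nonneg[OF p(3)] by blast
  have sp: "supported_in f (p + \<sigma> * \<tau>) (spread n (mass ?t / 2) T)" if \<tau>: "0 \<le> \<tau>" "\<tau> \<le> T" for \<tau>
  proof (rule supported_in_mono)
    show "supported_in f (p + \<sigma> * \<tau>) (spread n (mass ?t / 2) \<tau>)"
      using \<tau> E m by (intro supported_in_spread[OF \<sigma> p(1) _ time _ _ n]) auto
    show "spread n (mass ?t / 2) \<tau> \<le> spread n (mass ?t / 2) T"
      using \<tau> m n by (intro spread_mono) auto
  qed
  have "spread n 0 0 \<le> spread n (mass ?t / 2) T" using m n p by (intro spread_mono) auto
  then have "0 < spread n (mass ?t / 2) T" using n by (simp add: spread_def)
  then have "mass (p + \<sigma> * 0) = mass ?t"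
    using sp p by (intro const[where R = "spread n (mass ?t / 2) T"]) auto
  then show ?thesis using sp[of T] p by simp
qed

text \<open>An intersection of zero sets of the continuous functions of time at fixed phase points;
  these are the closed sets for Baire's theorem.\<close>

lemma closed_supported_in: "closed {t \<in> {0..}. supported_in f t n}"
proof -
  have closed_zero: "closed {t \<in> {0..}. f t x (v, w) = 0}" for x v w
    by (intro continuous_closed_preimage_constant continuous_on_f) (auto intro!: continuous_intros)
  have "{t \<in> {0..}. supported_in f t n} =
      {0..} \<inter> (\<Inter>(x, v, w) \<in> {(x, v, w). n \<le> \<bar>x\<bar> \<or> n \<le> \<bar>v\<bar> \<or> n \<le> \<bar>w\<bar>}. {t \<in> {0..}. f t x (v, w) = 0})"
    unfolding supported_in_def by auto
  also have "closed \<dots>"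
    using closed_zero by (intro closed_Int closed_INT closed_atLeast) auto
  finally show ?thesis .
qed

text \<open>Times with support bound \<open>n\<close> need not form an interval, so conservation of
  mass cannot compare them. The integral over the fixed box is continuous at all times and equals
  the mass whenever the support fits.\<close>

lemma mass_bounded_of_supported_in:
  assumes "0 < n"
  shows "\<exists>C \<ge> 0. \<forall>t\<in>{0..T}. supported_in f t n \<longrightarrow> mass t \<le> C"
proof -
  let ?G = "\<lambda>t. integral (cbox (-n) n) (\<lambda>x. moment (f t x) n 0)"
  have "continuous_on ({0..T} \<times> cbox (-n) n) (\<lambda>z. moment (f (fst z) (snd z)) n 0)"
    by (intro continuous_on_moment_f continuous_intros) auto
  then have "continuous_on {0..T} ?G"
    by (intro integral_continuous_on_param) (simp add: case_prod_beta)
  then have "bounded (?G ` {0..T})"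
    by (intro compact_imp_bounded compact_continuous_image) auto
  then obtain C where C: "0 < C" "\<And>t. t \<in> {0..T} \<Longrightarrow> \<bar>?G t\<bar> \<le> C"
    unfolding bounded_pos by auto
  have "mass t \<le> C" if "t \<in> {0..T}" "supported_in f t n" for t
  proof -
    have "rho f t = (\<lambda>x. moment (f t x) n 0)"
      using that assms by (intro ext rho_eq_moment) auto
    then have "mass t = ?G t"
      using that assms by (simp add: mass_eq_integral[of t n])
    then show ?thesis using C(2)[OF that(1)] by simp
  qed
  then show ?thesis using C(1) by (intro exI[of _ C]) auto
qed

definition singular_times :: "real set" where
  "singular_times = {t \<in> {0..}. \<not> (\<exists>e > 0. \<exists>R > 0. \<forall>s \<ge> 0. \<bar>s - t\<bar> < e \<longrightarrow> supported_in f s R)}"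

lemma closed_singular_times: "closed singular_times"
proof -
  have "open (- singular_times)"
  proof (rule openI)
    fix t assume t: "t \<in> - singular_times"
    show "\<exists>e > 0. ball t e \<subseteq> - singular_times"
    proof (cases "t < 0")
      case True
      then show ?thesis
        by (intro exI[of _ "-t"]) (auto simp: singular_times_def dist_real_def)
    next
      case False
      then obtain e R where e: "0 < e" "0 < R" "\<And>s. 0 \<le> s \<Longrightarrow> \<bar>s - t\<bar> < e \<Longrightarrow> supported_in f s R"
        using t unfolding singular_times_def by auto
      have "u \<notin> singular_times" if "\<bar>u - t\<bar> < e / 2" for u
      proof -
        have "\<forall>s \<ge> 0. \<bar>s - u\<bar> < e / 2 \<longrightarrow> supported_in f s R"
          using e(3) that by (smt (verit) field_sum_of_halves)
        then show ?thesis unfolding singular_times_def using e(1,2) half_gt_zero by blast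
      qed
      then show ?thesis using e(1) by (intro exI[of _ "e / 2"]) (auto simp: dist_real_def abs_minus_commute)
    qed
  qed
  then show ?thesis by (simp add: closed_open)
qed

lemma uniform_support_regular:
  assumes "a \<le> b" "0 \<le> a" "{a..b} \<inter> singular_times = {}"
  shows "\<exists>R > 0. \<forall>t\<in>{a..b}. supported_in f t R"
proof -
  \<comment> \<open>The guard \<open>0 \<le> t\<close> is needed because the intervals in the
    bisection argument may extend below time 0.\<close>
  have "\<exists>R > 0. \<forall>t\<in>{a..b}. 0 \<le> t \<longrightarrow> supported_in f t R"
    using \<open>a \<le> b\<close>
  proof (induction rule: Bolzano)
    case (trans u v w)
    from trans(1) obtain R where R: "0 < R" "\<forall>t\<in>{u..v}. 0 \<le> t \<longrightarrow> supported_in f t R" by auto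
    from trans(2) obtain S where S: "0 < S" "\<forall>t\<in>{v..w}. 0 \<le> t \<longrightarrow> supported_in f t S" by auto
    have "supported_in f t (max R S)" if "t \<in> {u..w}" "0 \<le> t" for t
    proof (cases "t \<le> v")
      case True
      then have "supported_in f t R" using R(2) that by auto
      then show ?thesis by (rule supported_in_mono) simp
    next
      case False
      then have "supported_in f t S" using S(2) that by auto
      then show ?thesis by (rule supported_in_mono) simp
    qed
    then show ?case using R(1) by (intro exI[of _ "max R S"]) auto
  next
    case (local x)
    then have "x \<notin> singular_times" "0 \<le> x" using assms by auto
    then obtain e R where e: "0 < e" "0 < R" "\<And>s. 0 \<le> s \<Longrightarrow> \<bar>s - x\<bar> < e \<Longrightarrow> supported_in f s R"
      unfolding singular_times_def by auto
    have "supported_in f t R" if "u \<le> x" "x \<le> v" "v - u < e" "t \<in> {u..v}" "0 \<le> t" for u v t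
      using that by (intro e(3)) auto
    then show ?case using e(1,2) by blast
  qed
  then show ?thesis using \<open>0 \<le> a\<close> by auto
qed

text \<open>By Baire's theorem some relatively open part of the singular set has a common support bound. A
  nearby regular time is separated from its closest singular time by a gap on which mass is conserved,
  so the bound propagates into the gap.\<close>

lemma singular_times_empty: "singular_times = {}"
proof (rule ccontr)
  assume ne: "singular_times \<noteq> {}"
  let ?P = "singular_times"
  let ?K = "\<lambda>n. {t \<in> {0..}. supported_in f t n}"
  \<comment> \<open>If all these relatively open sets were dense in the singular set, so would be
    their intersection; it is empty since each time has some bound. \<open>Suc\<close> keeps the
    bound positive.\<close>
  define U where "U = (\<lambda>n::nat. ?P - ?K (real (Suc n)))"
  have P0: "0 \<le> t" if "t \<in> ?P" for t using that by (simp add: singular_times_def)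
  have inter: "(\<Inter>n. U n) = {}"
  proof (rule equals0I)
    fix t assume t: "t \<in> (\<Inter>n. U n)"
    then obtain R where "supported_in f t R" using ex_supported_in[OF P0] by (auto simp: U_def)
    moreover obtain n :: nat where "R \<le> real n" using real_arch_simple by blast
    ultimately have "supported_in f t (real (Suc n))" using supported_in_mono by fastforce
    then show False using t P0 by (auto simp: U_def)
  qed
  have opn: "openin (top_of_set ?P) (U n)" for n
    using closed_supported_in[of "real (Suc n)"] unfolding U_def
    by (simp only: Diff_eq openin_open_Int open_Compl)
  have "\<exists>n. \<not> ?P \<subseteq> closure (U n)"
  proof (rule ccontr)
    assume "\<nexists>n. \<not> ?P \<subseteq> closure (U n)"
    then have "openin (top_of_set ?P) T \<and> ?P \<subseteq> closure T" if "T \<in> range U" for T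
      using opn that by blast
    from Baire[OF closed_singular_times _ this] have "?P \<subseteq> closure (\<Inter>n. U n)" by simp
    then show False using inter ne by simp
  qed
  then obtain n where "\<not> ?P \<subseteq> closure (U n)" by blast
  then obtain p where p: "p \<in> ?P" "p \<notin> closure (U n)" by blast
  define k where "k = real (Suc n)"
  have k: "0 < k" by (simp add: k_def)
  obtain e0 where e0: "0 < e0" "\<And>y. y \<in> U n \<Longrightarrow> e0 \<le> dist y p"
    using p(2) unfolding closure_approachable by (auto simp: not_less)
  \<comment> \<open>The cap 1 keeps all times considered below \<open>p + 1\<close> and all gaps
    shorter than 1, so \<open>C\<close> and \<open>R\<close> can be fixed in advance.\<close>
  define e where "e = min e0 1"
  have e: "0 < e" "e \<le> 1" using e0 by (auto simp: e_def)
  have sing: "supported_in f t k" if "t \<in> ?P" "\<bar>t - p\<bar> < e" for t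
  proof -
    have "t \<notin> U n" using that(2) e0(2)[of t] by (auto simp: dist_real_def e_def)
    then show ?thesis using that(1) P0[OF that(1)] by (simp add: k_def U_def)
  qed
  obtain C where C: "0 \<le> C" "\<And>t. t \<in> {0..p + 1} \<Longrightarrow> supported_in f t k \<Longrightarrow> mass t \<le> C"
    using mass_bounded_of_supported_in[OF k] by blast
  define R where "R = spread k (C / 2) 1"
  have "spread k 0 0 \<le> R" unfolding R_def using k C by (intro spread_mono) auto
  then have kR: "k \<le> R" by (simp add: spread_def)
  have "supported_in f t R" if t: "0 \<le> t" "\<bar>t - p\<bar> < e" for t
  proof (cases "t \<in> ?P")
    case True
    then show ?thesis using sing[OF _ t(2)] kR supported_in_mono by blast
  next
    case False
    \<comment> \<open>Only singular times between \<open>t\<close> and \<open>p\<close> compete, so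
      the closest one, \<open>a\<close>, still lies within \<open>e\<close> of \<open>p\<close> and
      inherits the bound \<open>k\<close>.\<close>
    define Z where "Z = ?P \<inter> {min t p..max t p}"
    have "closed Z" "p \<in> Z"
      using closed_singular_times p(1) by (auto simp: Z_def)
    then obtain a where a: "a \<in> Z" "\<And>z. z \<in> Z \<Longrightarrow> dist t a \<le> dist t z"
      using distance_attains_inf[of Z t] by blast
    have aP: "a \<in> ?P" and am: "min t p \<le> a" "a \<le> max t p" using a(1) by (auto simp: Z_def)
    have "a \<noteq> t" using aP False by blast
    define \<sigma> :: real where "\<sigma> = (if a < t then 1 else -1)"
    define T where "T = \<bar>t - a\<bar>"
    have \<sigma>: "\<sigma> = 1 \<or> \<sigma> = -1" by (simp add: \<sigma>_def)
    have T: "0 < T" "T \<le> 1" "a + \<sigma> * T = t"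
      using \<open>a \<noteq> t\<close> am t(2) e(2) by (auto simp: T_def \<sigma>_def abs_if min_def max_def split: if_splits)
    have ap: "\<bar>a - p\<bar> < e" using am t(2) by (auto simp: min_def max_def split: if_splits)
    have ka: "supported_in f a k" by (rule sing[OF aP ap])
    have ma: "mass a \<le> C" using ap e P0[OF aP] ka by (intro C(2)) auto
    have ma0: "0 \<le> mass a" using mass_nonneg[OF P0[OF aP] k ka] .
    have gap: "s \<notin> ?P" if "0 < \<tau>" "s \<in> {min (a + \<sigma> * \<tau>) t..max (a + \<sigma> * \<tau>) t}" "\<tau> \<le> T" for s \<tau>
    proof
      assume "s \<in> ?P"
      have s: "\<bar>t - s\<bar> < T" "min t p \<le> s" "s \<le> max t p"
        using that T am \<open>a \<noteq> t\<close>
        by (auto simp: T_def \<sigma>_def abs_if min_def max_def split: if_splits)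
      then have "s \<in> Z" using \<open>s \<in> ?P\<close> by (simp add: Z_def)
      then show False using a(2)[of s] s(1) by (simp add: dist_real_def T_def)
    qed
    \<comment> \<open>Away from \<open>a\<close> the gap is regular, so each
      \<open>{\<tau>..T}\<close> has some bound, possibly depending on \<open>\<tau>\<close>. The
      resulting spread involves only \<open>k\<close>, \<open>mass a \<le> C\<close> and
      \<open>T \<le> 1\<close>, hence is uniform in \<open>t\<close>.\<close>
    have "supported_in f (a + \<sigma> * T) (spread k (mass a / 2) T)"
    proof (rule supported_in_spread_mass[OF \<sigma> P0[OF aP] T(1) _ _ k ka])
      show "0 \<le> a + \<sigma> * T" using T t by simp
      fix \<tau> assume \<tau>: "0 < \<tau>" "\<tau> \<le> T"
      let ?lo = "min (a + \<sigma> * \<tau>) t" and ?hi = "max (a + \<sigma> * \<tau>) t"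
      have "\<exists>R > 0. \<forall>s\<in>{?lo..?hi}. supported_in f s R"
      proof (rule uniform_support_regular)
        show "0 \<le> ?lo" using P0[OF aP] t \<tau> T by (auto simp: \<sigma>_def min_def split: if_splits)
        show "{?lo..?hi} \<inter> ?P = {}" using gap[OF \<tau>(1) _ \<tau>(2)] by blast
      qed simp
      then obtain R where R: "0 < R" "\<And>s. s \<in> {?lo..?hi} \<Longrightarrow> supported_in f s R" by blast
      have "supported_in f (a + \<sigma> * s) R" if "s \<in> {\<tau>..T}" for s
        using that T by (intro R(2)) (auto simp: \<sigma>_def min_def max_def split: if_splits)
      then show "\<exists>R > 0. \<forall>s\<in>{\<tau>..T}. supported_in f (a + \<sigma> * s) R" using R(1) by blast
    qed
    moreover have "spread k (mass a / 2) T \<le> R"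
      unfolding R_def using ma ma0 T k by (intro spread_mono) auto
    ultimately show ?thesis using T(3) supported_in_mono by metis
  qed
  then have "\<exists>e > 0. \<exists>R > 0. \<forall>s \<ge> 0. \<bar>s - p\<bar> < e \<longrightarrow> supported_in f s R"
    using e(1) k kR by (intro exI[of _ e] conjI exI[of _ R]) auto
  then have "p \<notin> ?P" unfolding singular_times_def by blast
  then show False using p(1) by blast
qed

lemma uniform_support: "\<exists>R > 0. \<forall>t\<in>{0..b}. supported_in f t R" if "0 \<le> b"
  using uniform_support_regular[of 0 b] that by (simp add: singular_times_empty)

lemma mass_conserved:
  assumes "0 \<le> t"
  shows "mass t = mass 0"
proof -
  obtain R where "0 < R" "\<And>s. s \<in> {0..t} \<Longrightarrow> supported_in f s R"
    using uniform_support[OF assms] by blast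
  then show ?thesis using assms by (intro mass_constant_on[of 0 R t]) auto
qed

section \<open>Growth of the velocity support\<close>

lemma abs_v_le_Q1:
  assumes "0 \<le> t" "f t x (v, w) \<noteq> 0"
  shows "\<bar>v\<bar> \<le> Q1 f t"
proof -
  obtain R where R: "supported_in f t R" using ex_supported_in[OF assms(1)] by blast
  have "bdd_above {\<bar>v\<bar> | v. \<exists>x w. f t x (v, w) \<noteq> 0}"
    by (rule bdd_aboveI[of _ R]) (use supported_inD[OF R] in force)
  then show ?thesis
    unfolding Q1_def using assms(2) by (intro cSup_upper) auto
qed

lemma Q1_upper:
  assumes "supported_in f 0 R" "0 \<le> t" "0 < mass 0"
  shows "Q1 f t \<le> R + mass 0 / 2 * t"
  unfolding Q1_def
proof (rule cSup_least)
  \<comment> \<open>A least-upper-bound argument needs a nonempty set; conserved positive mass keeps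
    the support nonempty.\<close>
  have "\<exists>x v. f t x v \<noteq> 0"
  proof (rule ccontr)
    assume "\<not> ?thesis"
    then have "f t x v = 0" for x v by blast
    then have "mass t = 0" by (simp add: mass_def rho_def)
    then show False using mass_conserved[OF assms(2)] assms(3) by simp
  qed
  then show "{\<bar>v\<bar> | v. \<exists>x w. f t x (v, w) \<noteq> 0} \<noteq> {}" by auto
next
  fix y assume "y \<in> {\<bar>v\<bar> | v. \<exists>x w. f t x (v, w) \<noteq> 0}"
  \<comment> \<open>The form \<open>0 + 1 * t\<close> matches \<open>support_cone\<close> with base
    time 0 and forward direction.\<close>
  then obtain x0 v0 w0 where y: "y = \<bar>v0\<bar>" and nz: "f (0 + 1 * t) x0 (v0, w0) \<noteq> 0" by auto
  have E: "\<bar>E1 f (0 + 1 * s) x\<bar> \<le> mass 0 / 2" if "0 < s" for s x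
    using ex_supported_in[of s] abs_E1_le[of s _ x] mass_conserved[of s] that by auto
  obtain x v where "\<bar>v - v0\<bar> \<le> mass 0 / 2 * t" "f 0 x (v, w0) \<noteq> 0"
    using support_cone[OF _ _ assms(2) _ _ E nz] assms by auto
  then show "y \<le> R + mass 0 / 2 * t"
    using supported_inD[OF assms(1), of x v w0] y by linarith
qed

text \<open>The drift gains at least \<open>t * M ^ 3 / 12\<close>, with M the mass, and is at most
  \<open>M\<^sup>2 / 2\<close> times \<open>Q1\<close> at either end; division by
  \<open>M\<^sup>2 / 2\<close> gives the slope M/6.\<close>

lemma Q1_lower:
  assumes "0 \<le> t" "0 < mass 0"
  shows "mass 0 / 6 * t - Q1 f 0 \<le> Q1 f t"
proof -
  obtain R where R: "0 < R" "\<And>s. s \<in> {0..t} \<Longrightarrow> supported_in f s R"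
    using uniform_support[OF assms(1)] by blast
  interpret slab: vlasov_poisson_slab f D 0 t R
    using assms R by unfold_locales auto
  let ?m = "mass 0"
  have "t * ?m ^ 3 / 12 \<le> slab.drift t - slab.drift 0" using slab.drift_growth by simp
  also have "\<dots> \<le> Q1 f t * ?m\<^sup>2 / 2 + Q1 f 0 * ?m\<^sup>2 / 2"
    using slab.abs_drift_le[of t "Q1 f t"] slab.abs_drift_le[of 0 "Q1 f 0"] abs_v_le_Q1 assms by force
  finally have "(?m / 6 * t) * (?m\<^sup>2 / 2) \<le> (Q1 f t + Q1 f 0) * (?m\<^sup>2 / 2)"
    by (simp add: power2_eq_square power3_eq_cube algebra_simps)
  then have "?m / 6 * t \<le> Q1 f t + Q1 f 0"
    by (rule mult_right_le_imp_le) (use assms(2) in simp)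
  then show ?thesis by simp
qed

end

theorem theorem1p5:
  fixes f0 :: "real \<Rightarrow> real \<times> real \<Rightarrow> real"
    and f :: "real \<Rightarrow> real \<Rightarrow> real \<times> real \<Rightarrow> real"
  assumes f0_nonneg: "\<And>x v. 0 \<le> f0 x v"
    and f0_C1: "C1_on UNIV (\<lambda>(x, v). f0 x v)"
    and f0_compact: "compactly_supported (\<lambda>(x, v). f0 x v)"
    and f0_nonzero: "\<exists>x v. f0 x v \<noteq> 0"
    and sol: "vlasov_poisson_solution f0 f"
  shows "\<exists>T C1 C2 :: real. T > 0 \<and> C1 > 0 \<and> C2 > 0 \<and>
           (\<forall>t\<ge>T. C1 * t \<le> Q1 f t \<and> Q1 f t \<le> C2 * t)"
proof -
  have "C1_on ({0..} \<times> UNIV) (\<lambda>(t, x, v). f t x v)"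
    using sol unfolding vlasov_poisson_solution_def by (elim conjE)
  then obtain D where D: "\<forall>z \<in> {0..} \<times> UNIV.
      ((\<lambda>(t, x, v). f t x v) has_derivative blinfun_apply (D z)) (at z within {0..} \<times> UNIV)"
    "continuous_on ({0..} \<times> UNIV) D"
    unfolding C1_on_def by (elim exE conjE)
  interpret vlasov_poisson f D
  proof
    show "((\<lambda>(t, x, v). f t x v) has_derivative blinfun_apply (D z)) (at z within {0..} \<times> UNIV)"
      if "z \<in> {0..} \<times> UNIV" for z
      using D(1) that by (rule bspec)
  qed (use D(2) sol in \<open>auto simp: vlasov_poisson_solution_def\<close>)
  obtain R where R: "0 < R" "supported_in f 0 R" using ex_supported_in[of 0] by auto
  obtain x v where "f 0 x v \<noteq> 0" using f0_nonzero sol by (auto simp: vlasov_poisson_solution_def)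
  then have m: "0 < mass 0" using mass_pos[OF _ R] by simp
  \<comment> \<open>From this time on the loss \<open>Q1 f 0\<close> costs at most half of the slope
    M/6, leaving M/12; \<open>1 \<le> T\<close> absorbs the initial size \<open>R\<close> into
    \<open>R * t\<close>.\<close>
  define T where "T = max 1 (12 * \<bar>Q1 f 0\<bar> / mass 0)"
  have T: "1 \<le> T" by (simp add: T_def)
  have "mass 0 / 12 * t \<le> Q1 f t \<and> Q1 f t \<le> (R + mass 0 / 2) * t" if t: "T \<le> t" for t
  proof
    have "12 * \<bar>Q1 f 0\<bar> / mass 0 \<le> t" using t by (simp add: T_def)
    then have "\<bar>Q1 f 0\<bar> \<le> mass 0 / 12 * t" using m by (simp add: field_simps)
    then show "mass 0 / 12 * t \<le> Q1 f t" using Q1_lower[of t] m t T by (simp add: field_simps)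
    have "R * 1 \<le> R * t" using R t T by (intro mult_left_mono) auto
    then show "Q1 f t \<le> (R + mass 0 / 2) * t"
      using Q1_upper[OF R(2), of t] m t T by (simp add: algebra_simps)
  qed
  then show ?thesis
    using T m R by (intro exI[of _ T] exI[of _ "mass 0 / 12"] exI[of _ "R + mass 0 / 2"]) auto
qed

end
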